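(* Let $J,N\in\mathbb{Z}^+$ and let $U^0\in\mathbb{R}^{J-1}$ be given. Then the implicit difference equations $$\delta_tU_j^{1/2}+\nabla U_j^1\,\Delta_xU_j^1=I^{(\alpha)}\delta_x^2U_j^{1/2}+f_j^{1/2},\qquad 1\le j\le J-1,$$ $$\delta_tU_j^{n-1/2}+\nabla U_j^{n-1/2}\,\Delta_xU_j^{n-1/2}=I^{(\alpha)}\delta_x^2U_j^{n-1/2}+f_j^{n-1/2},\qquad 1\le j\le J-1,\ 2\le n\le N,$$ with boundary values $U_0^n=U_J^n=0$ for $1\le n\le N$, have a solution $U^n=(U^n_1,\dots,U^n_{J-1})\in\mathbb{R}^{J-1}$, $1\le n\le N$.
   Context: Fix $L,T>0$, $0<\alpha<1$ and the kernel $\beta(t)=t^{\alpha-1}/\Gamma(\alpha)$. Grids: $h=L/J$, $x_j=jh$ ($0\le j\le J$); temporal levels $0=t_0<t_1<\dots<t_N=T$, $k_n=t_n-t_{n-1}$. Time operators, for a sequence $W^0,\dots,W^N$: $\delta_tW^{n-1/2}=\frac{1}{k_n}(W^n-W^{n-1})$ and $W^{n-1/2}=\frac12(W^n+W^{n-1})$ for $n\ge1$. The discrete fractional integral is $$I^{(\alpha)}W^{n-1/2}=\widehat w_{n1}W^1k_1+\sum_{s=2}^{n}\widehat w_{ns}W^{s-1/2}k_s,\qquad \widehat w_{ns}=\frac{1}{k_nk_s}\int_{t_{n-1}}^{t_n}\int_{t_{s-1}}^{\min\{t,t_s\}}\beta(t-\zeta)\,d\zeta\,dt$$ (so $I^{(\alpha)}W^{1/2}=\widehat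 w_{11}W^1k_1$); $I^{(\alpha)}\delta_x^2U_j^{n-1/2}$ means this expression with $W^m=\delta_x^2U_j^m$. Space operators, for $W=(W_0,\dots,W_J)$ and $1\le j\le J-1$: $\Delta_xW_j=\frac{1}{2h}(W_{j+1}-W_{j-1})$, $\delta_x^2W_j=\frac{1}{h^2}(W_{j+1}-2W_j+W_{j-1})$, $\nabla W_j=\frac13(W_{j-1}+W_j+W_{j+1})$. The products $\nabla U_j\,\Delta_xU_j$ are pointwise. The numbers $f_j^{n-1/2}$ are given real data (approximations of $\frac1{k_n}\int_{t_{n-1}}^{t_n}f(x_j,t)\,dt$ for a source term $f$, for instance $\frac12(f(x_j,t_n)+f(x_j,t_{n-1}))$). *)

theory Defs
  imports "HOL-Analysis.Analysis"
begin

text \<open>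
  Conventions. A sequence of time levels \<open>W\<^sup>0, \<dots>, W\<^sup>N\<close> is a function on \<open>nat\<close> of which only the
  values at \<open>0, \<dots>, N\<close> matter; likewise a grid function \<open>W\<^sub>0, \<dots>, W\<^sub>J\<close> in space. A grid function in
  space and time is written \<open>U n j\<close>, time index first. The natural number \<open>n \<ge> 1\<close> stands for the
  half-integer level \<open>n - 1/2\<close> wherever a quantity lives at half-integer levels.
\<close>

definition frac_kernel :: "real \<Rightarrow> real \<Rightarrow> real" where
  "frac_kernel \<alpha> x = x powr (\<alpha> - 1) / Gamma \<alpha>"

definition time_grid :: "(nat \<Rightarrow> real) \<Rightarrow> real \<Rightarrow> nat \<Rightarrow> bool" where
  "time_grid t T N \<longleftrightarrow> t 0 = 0 \<and> t N = T \<and> strict_mono_on {0..N} t"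

definition time_step :: "(nat \<Rightarrow> real) \<Rightarrow> nat \<Rightarrow> real" where
  "time_step t n = t n - t (n - 1)"

definition time_diff :: "(nat \<Rightarrow> real) \<Rightarrow> (nat \<Rightarrow> real) \<Rightarrow> nat \<Rightarrow> real" where
  "time_diff t W n = (W n - W (n - 1)) / time_step t n"

definition time_avg :: "(nat \<Rightarrow> real) \<Rightarrow> nat \<Rightarrow> real" where
  "time_avg W n = (W n + W (n - 1)) / 2"

definition frac_weight :: "real \<Rightarrow> (nat \<Rightarrow> real) \<Rightarrow> nat \<Rightarrow> nat \<Rightarrow> real" where
  "frac_weight \<alpha> t n s =
     1 / (time_step t n * time_step t s) *
       integral {t (n - 1)..t n}
         (\<lambda>\<tau>. integral {t (s - 1)..min \<tau> (t s)} (\<lambda>\<zeta>. frac_kernel \<alpha> (\<tau> - \<zeta>)))"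

definition frac_int :: "real \<Rightarrow> (nat \<Rightarrow> real) \<Rightarrow> (nat \<Rightarrow> real) \<Rightarrow> nat \<Rightarrow> real" where
  "frac_int \<alpha> t W n =
     frac_weight \<alpha> t n 1 * W 1 * time_step t 1 +
     (\<Sum>s = 2..n. frac_weight \<alpha> t n s * time_avg W s * time_step t s)"

definition central_diff :: "real \<Rightarrow> (nat \<Rightarrow> real) \<Rightarrow> nat \<Rightarrow> real" where
  "central_diff h W j = (W (j + 1) - W (j - 1)) / (2 * h)"

definition second_diff :: "real \<Rightarrow> (nat \<Rightarrow> real) \<Rightarrow> nat \<Rightarrow> real" where
  "second_diff h W j = (W (j + 1) - 2 * W j + W (j - 1)) / h\<^sup>2"

definition three_point_avg :: "(nat \<Rightarrow> real) \<Rightarrow> nat \<Rightarrow> real" where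
  "three_point_avg W j = (W (j - 1) + W j + W (j + 1)) / 3"

end

theory Submission
  imports Defs
begin

text \<open>
  The scheme is solved one time level at a time. At the first level the unknown is
  \<open>V = U\<^sup>1\<close>; at a later level it is the time average \<open>V = (U\<^sup>n + U\<^sup>n\<^sup>-\<^sup>1)/2\<close>, from which
  \<open>U\<^sup>n = 2V - U\<^sup>n\<^sup>-\<^sup>1\<close> is recovered. The diagonal term of the discrete fractional integral is the only
  one that contains the new level, and it contains it through \<open>V\<close>. So every level amounts to the same
  nonlinear system
  \<open>a V\<^sub>j + \<nabla>V\<^sub>j \<Delta>\<^sub>x V\<^sub>j = w \<delta>\<^sub>x\<^sup>2 V\<^sub>j + b\<^sub>j\<close> with zero boundary values, where \<open>a > 0\<close> comes from the
  time difference, \<open>w \<ge> 0\<close> because the kernel is nonnegative (\<open>frac_weight_nonneg\<close>), and \<open>b\<close>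
  collects the source and the earlier levels.

  This system has a solution because of an energy estimate. Multiply by \<open>V\<^sub>j\<close> and sum over \<open>j\<close>: the
  convection term drops out, since the three-point average makes its sum telescope
  (\<open>convection_energy\<close>), and the diffusion term has the good sign (\<open>diffusion_energy\<close>). Hence the map
  \<open>\<Phi>\<close> whose zeros are the solutions satisfies \<open>\<langle>\<Phi>(V), V\<rangle> \<ge> a |V|\<^sup>2 - \<langle>b, V\<rangle>\<close>, which is nonnegative on a
  large sphere. A continuous map with this property has a zero
  (\<open>zero_of_outward_map\<close>), for otherwise \<open>V \<mapsto> - R \<Phi>(V) / |\<Phi>(V)|\<close> would have a Brouwer fixed point at
  which \<open>\<langle>\<Phi>(V), V\<rangle> < 0\<close>.

  The number \<open>J - 1\<close> of unknowns is a variable of the theorem, so Brouwer's theorem is needed for a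
  dimension that is a number and not a type. It is derived for cubes of real sequences
  from Kuhn's combinatorial lemma (\<open>fixed_point_on_cube\<close>).
\<close>

section \<open>Brouwer's fixed point theorem in numerical dimension\<close>

text \<open>
  The \<open>n\<close>-dimensional cube lives in the space of all sequences, with the product topology.
  Fixing the coordinates from \<open>n\<close> on at \<open>0\<close> keeps it compact.
\<close>
definition cube :: "nat \<Rightarrow> real \<Rightarrow> (nat \<Rightarrow> real) set" where
  "cube n R = {x. (\<forall>i<n. \<bar>x i\<bar> \<le> R) \<and> (\<forall>i\<ge>n. x i = 0)}"

lemma compact_cube: "compact (cube n R)"
proof -
  have "cube n R = (\<Pi>\<^sub>E i\<in>UNIV. if i < n then {-R..R} else {0})"
    unfolding cube_def
  proof (intro set_eqI)
    fix x :: "nat \<Rightarrow> real"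
    show "x \<in> {x. (\<forall>i<n. \<bar>x i\<bar> \<le> R) \<and> (\<forall>i\<ge>n. x i = 0)} \<longleftrightarrow>
          x \<in> (\<Pi>\<^sub>E i\<in>UNIV. if i < n then {-R..R} else {0})"
      by (force simp: PiE_iff abs_le_iff not_less[symmetric])
  qed
  moreover have "compactin (product_topology (\<lambda>i. euclidean) UNIV)
      (\<Pi>\<^sub>E i\<in>UNIV. if i < n then {-R..R} else {0})"
    unfolding compactin_PiE by auto
  ultimately show ?thesis
    by (simp add: euclidean_product_topology flip: compactin_euclidean_iff)
qed

text \<open>
  On a grid of mesh \<open>2R/p\<close>, mark each coordinate of a grid point by whether \<open>f\<close> moves it up or down.
  Kuhn's lemma gives a cell in which every coordinate occurs with both marks; so near \<open>z\<close> each
  coordinate is moved up somewhere and down somewhere. As \<open>p\<close> grows, continuity will force equality.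
\<close>
lemma kuhn_almost_fixed_point:
  fixes f :: "(nat \<Rightarrow> real) \<Rightarrow> nat \<Rightarrow> real"
  assumes R: "R > 0" and p: "p > 0"
    and maps: "\<And>x i. x \<in> cube n R \<Longrightarrow> i < n \<Longrightarrow> \<bar>f x i\<bar> \<le> R"
  obtains z where "z \<in> cube n R"
    and "\<And>i. i < n \<Longrightarrow> \<exists>u v. (\<forall>j. \<bar>u j - z j\<bar> \<le> 2 * R / real p) \<and> (\<forall>j. \<bar>v j - z j\<bar> \<le> 2 * R / real p)
           \<and> u i \<le> f u i \<and> f v i \<le> v i"
proof -
  define pt where "pt x = (\<lambda>j. if j < n then - R + 2 * R * real (x j) / real p else 0)" for x
  have pt_cube: "pt x \<in> cube n R" if "\<forall>i<n. x i \<le> p" for x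
  proof -
    have "2 * R * real (x i) / real p \<le> 2 * R" if "i < n" for i
      using that \<open>\<forall>i<n. x i \<le> p\<close> R p by (simp add: field_simps)
    moreover have "0 \<le> 2 * R * real (x i) / real p" for i
      using R by simp
    ultimately show ?thesis by (fastforce simp: cube_def pt_def abs_le_iff)
  qed
  \<comment> \<open>Label 0 means "up", label 1 means "down". On the two faces the label is prescribed by Kuhn's lemma;
      there it has the stated meaning because \<open>f\<close> stays in the cube.\<close>
  define label :: "(nat \<Rightarrow> nat) \<Rightarrow> nat \<Rightarrow> nat" where
    "label x i = (if x i = p \<or> (x i \<noteq> 0 \<and> f (pt x) i < pt x i) then 1 else 0)" for x i
  have label0: "pt x i \<le> f (pt x) i" if "\<forall>i<n. x i \<le> p" "i < n" "label x i = 0" for x i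
    using that maps[OF pt_cube[OF that(1)] that(2)]
    by (cases "x i = 0") (auto simp: label_def pt_def split: if_splits)
  have label1: "f (pt x) i \<le> pt x i" if "\<forall>i<n. x i \<le> p" "i < n" "label x i = 1" for x i
    using that maps[OF pt_cube[OF that(1)] that(2)] p
    by (cases "x i = p") (auto simp: label_def pt_def split: if_splits)
  obtain q where q: "\<forall>i<n. q i < p"
    and rs: "\<forall>i<n. \<exists>r s. (\<forall>j<n. q j \<le> r j \<and> r j \<le> q j + 1) \<and>
      (\<forall>j<n. q j \<le> s j \<and> s j \<le> q j + 1) \<and> label r i \<noteq> label s i"
    by (rule kuhn_lemma[of p n label]) (use p in \<open>auto simp: label_def\<close>)
  have close: "\<bar>pt r j - pt q j\<bar> \<le> 2 * R / real p"
    if "\<forall>j<n. q j \<le> r j \<and> r j \<le> q j + 1" for r j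
  proof (cases "j < n")
    case True
    then have "\<bar>real (r j) - real (q j)\<bar> \<le> 1" using that by fastforce
    then have "\<bar>(2 * R / real p) * (real (r j) - real (q j))\<bar> \<le> 2 * R / real p"
      using R by (simp add: abs_mult divide_right_mono)
    moreover have "pt r j - pt q j = (2 * R / real p) * (real (r j) - real (q j))"
      using True by (simp add: pt_def algebra_simps diff_divide_distrib)
    ultimately show ?thesis by simp
  next
    case False
    then show ?thesis using R by (simp add: pt_def)
  qed
  show thesis
  proof
    show "pt q \<in> cube n R" using q by (intro pt_cube) (auto intro: less_imp_le)
    fix i assume i: "i < n"
    obtain r s where r: "\<forall>j<n. q j \<le> r j \<and> r j \<le> q j + 1"
      and s: "\<forall>j<n. q j \<le> s j \<and> s j \<le> q j + 1" and ne: "label r i \<noteq> label s i"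
      using rs[THEN spec, THEN mp, OF i] by (elim exE conjE)
    have rp: "\<forall>j<n. r j \<le> p" and sp: "\<forall>j<n. s j \<le> p"
      using r s q by (metis Suc_eq_plus1 Suc_leI le_trans)+
    have "label r i = 0 \<and> label s i = 1 \<or> label s i = 0 \<and> label r i = 1"
      using ne by (auto simp: label_def split: if_splits)
    then show "\<exists>u v. (\<forall>j. \<bar>u j - pt q j\<bar> \<le> 2 * R / real p) \<and> (\<forall>j. \<bar>v j - pt q j\<bar> \<le> 2 * R / real p)
           \<and> u i \<le> f u i \<and> f v i \<le> v i"
    proof (elim disjE conjE)
      assume "label r i = 0" "label s i = 1"
      then show ?thesis
        using label0[OF rp i] label1[OF sp i] close[OF r] close[OF s]
        by (intro exI[of _ "pt r"] exI[of _ "pt s"]) simp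
    next
      assume "label s i = 0" "label r i = 1"
      then show ?thesis
        using label0[OF sp i] label1[OF rp i] close[OF r] close[OF s]
        by (intro exI[of _ "pt s"] exI[of _ "pt r"]) simp
    qed
  qed
qed

text \<open>
  The almost fixed points have a convergent subsequence by compactness. The neighbouring points at
  which a coordinate is moved up or down converge to the same limit, so passing to the limit in
  \<open>u i \<le> f u i\<close> and \<open>f v i \<le> v i\<close> gives both inequalities at one point.
\<close>
lemma fixed_point_on_cube:
  fixes f :: "(nat \<Rightarrow> real) \<Rightarrow> nat \<Rightarrow> real"
  assumes R: "R > 0"
    and cont: "\<And>i. i < n \<Longrightarrow> continuous_on UNIV (\<lambda>x. f x i)"
    and maps: "\<And>x i. x \<in> cube n R \<Longrightarrow> i < n \<Longrightarrow> \<bar>f x i\<bar> \<le> R"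
  obtains x where "x \<in> cube n R" "\<And>i. i < n \<Longrightarrow> f x i = x i"
proof -
  have "\<exists>z. z \<in> cube n R \<and> (\<forall>i<n. \<exists>u v. (\<forall>j. \<bar>u j - z j\<bar> \<le> 2 * R / real (Suc m)) \<and>
      (\<forall>j. \<bar>v j - z j\<bar> \<le> 2 * R / real (Suc m)) \<and> u i \<le> f u i \<and> f v i \<le> v i)" for m
    using kuhn_almost_fixed_point[of R "Suc m" n f] R maps by (metis zero_less_Suc)
  then obtain z where z: "\<And>m. z m \<in> cube n R"
    and near: "\<And>m i. i < n \<Longrightarrow> \<exists>u v. (\<forall>j. \<bar>u j - z m j\<bar> \<le> 2 * R / real (Suc m)) \<and>
      (\<forall>j. \<bar>v j - z m j\<bar> \<le> 2 * R / real (Suc m)) \<and> u i \<le> f u i \<and> f v i \<le> v i"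
    by metis
  obtain x \<sigma> where x: "x \<in> cube n R" and \<sigma>: "strict_mono \<sigma>" and lim: "(z \<circ> \<sigma>) \<longlonglongrightarrow> x"
    using compact_imp_seq_compact[OF compact_cube, of n R] z unfolding seq_compact_def by metis
  have rate: "(\<lambda>k. 2 * R / real (Suc (\<sigma> k))) \<longlonglongrightarrow> 0"
    using LIMSEQ_subseq_LIMSEQ[OF tendsto_mult[OF tendsto_const[of "2 * R"] LIMSEQ_inverse_real_of_nat] \<sigma>]
    by (simp add: o_def divide_inverse)
  have follow: "u \<longlonglongrightarrow> x" if "\<And>k j. \<bar>u k j - z (\<sigma> k) j\<bar> \<le> 2 * R / real (Suc (\<sigma> k))" for u
  proof -
    have "(\<lambda>k. u k j) \<longlonglongrightarrow> x j" for j
    proof -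
      have gap: "(\<lambda>k. u k j - z (\<sigma> k) j) \<longlonglongrightarrow> 0"
        by (rule Lim_null_comparison[OF _ rate]) (use that in auto)
      have "(\<lambda>k. z (\<sigma> k) j) \<longlonglongrightarrow> x j"
        using continuous_on_tendsto_compose[OF continuous_on_product_coordinates[of j] lim]
        by (simp add: o_def)
      then show ?thesis using gap by (rule Lim_transform)
    qed
    then have "limitin (product_topology (\<lambda>_. euclidean) UNIV) u x sequentially"
      unfolding limitin_componentwise by simp
    then show ?thesis by (simp add: euclidean_product_topology)
  qed
  have "f x i = x i" if i: "i < n" for i
  proof -
    obtain u v where u: "\<And>m j. \<bar>u m j - z m j\<bar> \<le> 2 * R / real (Suc m)"
      and v: "\<And>m j. \<bar>v m j - z m j\<bar> \<le> 2 * R / real (Suc m)"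
      and fu: "\<And>m. u m i \<le> f (u m) i" and fv: "\<And>m. f (v m) i \<le> v m i"
      using near[OF i] by metis
    have ul: "(\<lambda>k. u (\<sigma> k)) \<longlonglongrightarrow> x" and vl: "(\<lambda>k. v (\<sigma> k)) \<longlonglongrightarrow> x"
      using follow u v by auto
    have "x i \<le> f x i"
      using continuous_on_tendsto_compose[OF continuous_on_product_coordinates[of i] ul]
        continuous_on_tendsto_compose[OF cont[OF i] ul] fu
      by (auto intro: LIMSEQ_le)
    moreover have "f x i \<le> x i"
      using continuous_on_tendsto_compose[OF continuous_on_product_coordinates[of i] vl]
        continuous_on_tendsto_compose[OF cont[OF i] vl] fv
      by (auto intro: LIMSEQ_le)
    ultimately show ?thesis by simp
  qed
  with x show thesis by (rule that)
qed

text \<open>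
  If \<open>\<Phi>\<close> had no zero supported on \<open>I\<close>, then \<open>- R \<Phi> / |\<Phi>|\<close> would map the cube continuously into the ball of radius
  \<open>R\<close>, which lies in the cube. A fixed point \<open>x\<close> lies on the sphere, and there
  \<open>\<langle>\<Phi> x, x\<rangle> = - R |\<Phi> x| < 0\<close>, against the assumption.
\<close>
lemma zero_of_outward_map:
  fixes \<Phi> :: "(nat \<Rightarrow> real) \<Rightarrow> nat \<Rightarrow> real"
  assumes I: "finite I" and R: "R > 0"
    and cont: "\<And>i. i \<in> I \<Longrightarrow> continuous_on UNIV (\<lambda>x. \<Phi> x i)"
    and outward: "\<And>x. (\<forall>i. i \<notin> I \<longrightarrow> x i = 0) \<Longrightarrow> (\<Sum>i\<in>I. (x i)\<^sup>2) = R\<^sup>2 \<Longrightarrow> 0 \<le> (\<Sum>i\<in>I. \<Phi> x i * x i)"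
  shows "\<exists>x. (\<forall>i. i \<notin> I \<longrightarrow> x i = 0) \<and> (\<forall>i\<in>I. \<Phi> x i = 0)"
proof (rule ccontr)
  assume "\<not> ?thesis"
  then have no_zero: "\<exists>i\<in>I. \<Phi> x i \<noteq> 0" if "\<forall>i. i \<notin> I \<longrightarrow> x i = 0" for x
    using that by blast
  obtain n where n: "\<And>i. i \<in> I \<Longrightarrow> i < n"
    using finite_nat_bounded[OF I] by auto
  \<comment> \<open>Only vectors supported on \<open>I\<close> are known not to be zeros. Composing with the projection \<open>P\<close>
      onto them keeps the denominator \<open>sqrt (S x)\<close> positive at every sequence.\<close>
  define P :: "(nat \<Rightarrow> real) \<Rightarrow> nat \<Rightarrow> real" where "P x = (\<lambda>i. if i \<in> I then x i else 0)" for x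
  have contP: "continuous_on UNIV P"
  proof (rule continuous_on_coordinatewise_then_product)
    show "continuous_on UNIV (\<lambda>x. P x i)" for i
      by (cases "i \<in> I") (auto simp: P_def)
  qed
  have contPhi: "continuous_on UNIV (\<lambda>x. \<Phi> (P x) i)" if "i \<in> I" for i
    using continuous_on_compose2[OF cont[OF that] contP] by simp
  define S where "S x = (\<Sum>i\<in>I. (\<Phi> (P x) i)\<^sup>2)" for x
  have S_pos: "S x > 0" for x
  proof -
    obtain i where "i \<in> I" "\<Phi> (P x) i \<noteq> 0" using no_zero[of "P x"] by (auto simp: P_def)
    then show ?thesis unfolding S_def using I by (intro sum_pos2[of I i]) auto
  qed
  define F where "F x i = (if i \<in> I then - R * \<Phi> (P x) i / sqrt (S x) else 0)" for x i
  have contF: "continuous_on UNIV (\<lambda>x. F x i)" for i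
  proof (cases "i \<in> I")
    case True
    have "continuous_on UNIV (\<lambda>x. - R * \<Phi> (P x) i / sqrt (S x))"
      using S_pos unfolding S_def
      by (intro continuous_intros contPhi True) (auto simp: less_imp_neq[symmetric] dest: less_imp_neq)
    then show ?thesis using True by (simp add: F_def)
  qed (simp add: F_def)
  have bound: "\<bar>F x i\<bar> \<le> R" for x i
  proof (cases "i \<in> I")
    case True
    then have "(\<Phi> (P x) i)\<^sup>2 \<le> S x"
      unfolding S_def using I by (intro member_le_sum) auto
    then have "\<bar>\<Phi> (P x) i\<bar> \<le> sqrt (S x)" by (simp add: real_le_rsqrt)
    then show ?thesis using True R S_pos[of x]
      by (simp add: F_def abs_mult abs_of_pos pos_divide_le_eq mult_left_mono)
  qed (use R in \<open>simp add: F_def\<close>)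
  obtain x where x: "x \<in> cube n R" and fix_x: "\<And>i. i < n \<Longrightarrow> F x i = x i"
    using fixed_point_on_cube[OF R, of n F] contF bound by metis
  have vanish: "\<forall>i. i \<notin> I \<longrightarrow> x i = 0"
  proof (intro allI impI)
    fix i assume "i \<notin> I"
    then show "x i = 0" using fix_x[of i] x by (cases "i < n") (auto simp: F_def cube_def)
  qed
  then have Px: "P x = x" by (auto simp: P_def)
  have xi: "x i = - R * \<Phi> x i / sqrt (S x)" if "i \<in> I" for i
    using fix_x[OF n[OF that]] that by (simp add: F_def Px)
  have "(\<Sum>i\<in>I. (x i)\<^sup>2) = (\<Sum>i\<in>I. R\<^sup>2 / S x * (\<Phi> x i)\<^sup>2)"
    using S_pos[of x] by (intro sum.cong) (auto simp: xi power_mult_distrib power_divide)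
  also have "\<dots> = R\<^sup>2 / S x * S x" by (simp add: S_def Px sum_distrib_left)
  finally have "(\<Sum>i\<in>I. (x i)\<^sup>2) = R\<^sup>2" using S_pos[of x] by simp
  then have "0 \<le> (\<Sum>i\<in>I. \<Phi> x i * x i)" using outward vanish by blast
  also have "\<dots> = (\<Sum>i\<in>I. - R / sqrt (S x) * (\<Phi> x i)\<^sup>2)"
    by (intro sum.cong) (auto simp: xi power2_eq_square)
  also have "\<dots> = - R / sqrt (S x) * S x" by (simp add: S_def Px sum_distrib_left)
  also have "\<dots> < 0" using R S_pos[of x] by simp
  finally show False by simp
qed

section \<open>Energy estimates and solvability at one time level\<close>

lemma sum_backward_diff:
  fixes F :: "nat \<Rightarrow> real"
  shows "(\<Sum>j = 1..m. F j - F (j - 1)) = F m - F 0"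
  by (induction m) auto

text \<open>
  This is the discrete form of \<open>\<integral> v\<^sup>2 v\<^sub>x = 0\<close>. The equal weights of the average are what makes the
  summand an exact difference:
  \<open>V\<^sub>j (V\<^sub>j\<^sub>-\<^sub>1 + V\<^sub>j + V\<^sub>j\<^sub>+\<^sub>1)(V\<^sub>j\<^sub>+\<^sub>1 - V\<^sub>j\<^sub>-\<^sub>1) = V\<^sub>j V\<^sub>j\<^sub>+\<^sub>1 (V\<^sub>j + V\<^sub>j\<^sub>+\<^sub>1) - V\<^sub>j\<^sub>-\<^sub>1 V\<^sub>j (V\<^sub>j\<^sub>-\<^sub>1 + V\<^sub>j)\<close>.
\<close>
lemma convection_energy:
  fixes V :: "nat \<Rightarrow> real"
  assumes "V 0 = 0" "V J = 0" "J \<ge> 1"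
  shows "(\<Sum>j = 1..J - 1. three_point_avg V j * central_diff h V j * V j) = 0"
proof -
  define F where "F j = V j * V (j + 1) * (V j + V (j + 1)) / (6 * h)" for j
  have "(\<Sum>j = 1..J - 1. three_point_avg V j * central_diff h V j * V j) = (\<Sum>j = 1..J - 1. F j - F (j - 1))"
  proof (rule sum.cong)
    fix j assume "j \<in> {1..J - 1}"
    then show "three_point_avg V j * central_diff h V j * V j = F j - F (j - 1)"
      by (cases "h = 0") (auto simp: F_def three_point_avg_def central_diff_def field_simps)
  qed simp
  also have "\<dots> = 0"
    unfolding sum_backward_diff using assms by (simp add: F_def)
  finally show ?thesis .
qed

text \<open>
  By \<open>2xy \<le> x\<^sup>2 + y\<^sup>2\<close>, the product \<open>2 V\<^sub>j (V\<^sub>j\<^sub>+\<^sub>1 - 2V\<^sub>j + V\<^sub>j\<^sub>-\<^sub>1)\<close> is at most the second difference of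
  \<open>V\<^sup>2\<close>, whose sum telescopes to \<open>- (V\<^sub>J\<^sub>-\<^sub>1\<^sup>2 + V\<^sub>1\<^sup>2)\<close>.
\<close>
lemma diffusion_energy:
  fixes V :: "nat \<Rightarrow> real"
  assumes "V 0 = 0" "V J = 0" "J \<ge> 1"
  shows "(\<Sum>j = 1..J - 1. second_diff h V j * V j) \<le> 0"
proof -
  define G where "G j = ((V (j + 1))\<^sup>2 - (V j)\<^sup>2) / (2 * h\<^sup>2)" for j
  have "(\<Sum>j = 1..J - 1. second_diff h V j * V j) \<le> (\<Sum>j = 1..J - 1. G j - G (j - 1))"
  proof (rule sum_mono)
    fix j assume "j \<in> {1..J - 1}"
    then have "G j - G (j - 1) = ((V (j + 1))\<^sup>2 - 2 * (V j)\<^sup>2 + (V (j - 1))\<^sup>2) / (2 * h\<^sup>2)"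
      by (simp add: G_def diff_divide_distrib add_divide_distrib)
    moreover have "second_diff h V j * V j = (2 * (V (j + 1) - 2 * V j + V (j - 1)) * V j) / (2 * h\<^sup>2)"
      by (cases "h = 0") (simp_all add: second_diff_def field_simps)
    moreover have "2 * (V (j + 1) - 2 * V j + V (j - 1)) * V j \<le> (V (j + 1))\<^sup>2 - 2 * (V j)\<^sup>2 + (V (j - 1))\<^sup>2"
      using zero_le_power2[of "V (j + 1) - V j"] zero_le_power2[of "V (j - 1) - V j"]
      unfolding power2_eq_square by (simp add: algebra_simps)
    ultimately show "second_diff h V j * V j \<le> G j - G (j - 1)"
      by (metis divide_right_mono zero_le_mult_iff zero_le_numeral zero_le_power2)
  qed
  also have "\<dots> = - ((V (J - 1))\<^sup>2 + (V 1)\<^sup>2) / (2 * h\<^sup>2)"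
    unfolding sum_backward_diff using assms by (simp add: G_def diff_divide_distrib add_divide_distrib)
  also have "\<dots> \<le> 0" by (simp add: divide_nonpos_nonneg)
  finally show ?thesis .
qed

text \<open>
  The energy of \<open>\<Phi>(V)\<close> against \<open>V\<close> is at least \<open>a |V|\<^sup>2 - \<langle>b, V\<rangle>\<close>, and
  \<open>\<langle>b, V\<rangle> \<le> a |V|\<^sup>2 / 2 + |b|\<^sup>2 / (2a)\<close>. So \<open>\<Phi>\<close> points outward on any sphere with \<open>R \<ge> |b| / a\<close>.
\<close>
lemma one_level_solvable:
  fixes a w h :: real and b :: "nat \<Rightarrow> real"
  assumes a: "a > 0" and w: "w \<ge> 0" and J: "J \<ge> 1"
  obtains V where "V 0 = 0" "V J = 0"
    "\<And>j. j \<in> {1..J - 1} \<Longrightarrow> a * V j + three_point_avg V j * central_diff h V j = w * second_diff h V j + b j"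
proof -
  define I where "I = {1..J - 1}"
  define \<Phi> where "\<Phi> V j = a * V j + three_point_avg V j * central_diff h V j - w * second_diff h V j - b j" for V j
  define B where "B = (\<Sum>j\<in>I. (b j)\<^sup>2)"
  \<comment> \<open>The summand \<open>1\<close> keeps the radius positive when \<open>b = 0\<close>.\<close>
  define R where "R = sqrt (B / a\<^sup>2 + 1)"
  have B: "B \<ge> 0" by (simp add: B_def sum_nonneg)
  have R2: "R\<^sup>2 = B / a\<^sup>2 + 1" using B by (simp add: R_def)
  have R: "R > 0" using B by (simp add: R_def add_nonneg_pos)
  have cont: "continuous_on UNIV (\<lambda>V. \<Phi> V j)" for j
    unfolding \<Phi>_def three_point_avg_def central_diff_def second_diff_def divide_inverse
    by (intro continuous_on_add continuous_on_diff continuous_on_mult continuous_on_const continuous_on_product_coordinates)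
  have outward: "0 \<le> (\<Sum>j\<in>I. \<Phi> V j * V j)"
    if vanish: "\<forall>j. j \<notin> I \<longrightarrow> V j = 0" and sphere: "(\<Sum>j\<in>I. (V j)\<^sup>2) = R\<^sup>2" for V
  proof -
    have V: "V 0 = 0" "V J = 0" using vanish J by (auto simp: I_def)
    have young: "b j * V j \<le> a * (V j)\<^sup>2 / 2 + (b j)\<^sup>2 / (2 * a)" for j
    proof -
      have "0 \<le> (a * V j - b j)\<^sup>2 / (2 * a)" using a by simp
      also have "\<dots> = a * (V j)\<^sup>2 / 2 + (b j)\<^sup>2 / (2 * a) - b j * V j"
        using a by (simp add: power2_eq_square field_simps)
      finally show ?thesis by simp
    qed
    have "(\<Sum>j\<in>I. b j * V j) \<le> (\<Sum>j\<in>I. a * (V j)\<^sup>2 / 2 + (b j)\<^sup>2 / (2 * a))"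
      by (rule sum_mono) (rule young)
    also have "\<dots> = a * R\<^sup>2 / 2 + B / (2 * a)"
      by (simp add: sum.distrib B_def flip: sphere sum_divide_distrib sum_distrib_left)
    also have "\<dots> \<le> a * R\<^sup>2"
      using a unfolding R2 by (simp add: field_simps power2_eq_square)
    finally have forcing: "(\<Sum>j\<in>I. b j * V j) \<le> a * R\<^sup>2" .
    have "(\<Sum>j\<in>I. \<Phi> V j * V j) = (\<Sum>j\<in>I. a * (V j)\<^sup>2 + three_point_avg V j * central_diff h V j * V j
        - w * (second_diff h V j * V j) - b j * V j)"
      by (rule sum.cong) (auto simp: \<Phi>_def algebra_simps power2_eq_square)
    also have "\<dots> = a * R\<^sup>2 + (\<Sum>j\<in>I. three_point_avg V j * central_diff h V j * V j)
        - w * (\<Sum>j\<in>I. second_diff h V j * V j) - (\<Sum>j\<in>I. b j * V j)"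
      by (simp add: sum.distrib sum_subtractf flip: sphere sum_distrib_left)
    also have "\<dots> = a * R\<^sup>2 - w * (\<Sum>j\<in>I. second_diff h V j * V j) - (\<Sum>j\<in>I. b j * V j)"
      using convection_energy[OF V J] by (simp add: I_def)
    also have "\<dots> \<ge> 0"
      using forcing mult_nonneg_nonpos[OF w diffusion_energy[OF V J, of h]] by (simp add: I_def)
    finally show ?thesis .
  qed
  have "finite I" by (simp add: I_def)
  from zero_of_outward_map[OF this R cont outward]
  obtain V where V: "\<And>j. j \<notin> I \<Longrightarrow> V j = 0" "\<And>j. j \<in> I \<Longrightarrow> \<Phi> V j = 0"
    by blast
  show thesis
  proof
    show "V 0 = 0" "V J = 0" using V(1) J by (auto simp: I_def)
    show "a * V j + three_point_avg V j * central_diff h V j = w * second_diff h V j + b j"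
      if "j \<in> {1..J - 1}" for j
      using V(2)[of j] that by (simp add: I_def \<Phi>_def)
  qed
qed

section \<open>The discrete fractional integral\<close>

lemma frac_weight_nonneg:
  assumes "\<alpha> > 0" "time_step t n \<ge> 0" "time_step t s \<ge> 0"
  shows "frac_weight \<alpha> t n s \<ge> 0"
proof -
  have kernel_ge_0: "0 \<le> frac_kernel \<alpha> x" for x
    using assms by (simp add: frac_kernel_def less_imp_le)
  \<comment> \<open>The integral of a function that is not integrable is \<open>0\<close>, so the bound covers that case too.\<close>
  have integral_ge_0: "0 \<le> integral A g" if "\<And>x. 0 \<le> g x" for A and g :: "real \<Rightarrow> real"
    using that by (cases "g integrable_on A") (simp_all add: integral_nonneg not_integrable_integral)
  have "0 \<le> integral {t (n - 1)..t n}
      (\<lambda>\<tau>. integral {t (s - 1)..min \<tau> (t s)} (\<lambda>\<zeta>. frac_kernel \<alpha> (\<tau> - \<zeta>)))"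
    by (intro integral_ge_0 kernel_ge_0)
  then show ?thesis using assms by (simp add: frac_weight_def)
qed

lemma frac_int_cong:
  assumes "n \<ge> 1" "\<And>m. 1 \<le> m \<Longrightarrow> m \<le> n \<Longrightarrow> W m = W' m"
  shows "frac_int \<alpha> t W n = frac_int \<alpha> t W' n"
proof -
  have "time_avg W s = time_avg W' s" if "s \<in> {2..n}" for s
    using that assms(2)[of s] assms(2)[of "s - 1"] by (auto simp: time_avg_def)
  then show ?thesis using assms by (simp add: frac_int_def)
qed

text \<open>
  Replacing the last value by \<open>- W (n - 1)\<close> makes the last time average zero, so the first term on the
  right is the part of the fractional integral that depends on the earlier levels only.
\<close>
lemma frac_int_split_last:
  assumes "n \<ge> 2"
  shows "frac_int \<alpha> t W n = frac_int \<alpha> t (W(n := - W (n - 1))) n + frac_weight \<alpha> t n n * time_step t n * time_avg W n"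
proof -
  define W' where "W' = W(n := - W (n - 1))"
  have "{2..n} = insert n {2..n - 1}" using assms by auto
  moreover have "time_avg W' s = time_avg W s" if "s \<in> {2..n - 1}" for s
  proof -
    have "s \<noteq> n" "s - 1 \<noteq> n" using that assms by auto
    then show ?thesis by (simp add: time_avg_def W'_def)
  qed
  moreover have "time_avg W' n = 0" using assms by (simp add: time_avg_def W'_def)
  moreover have "W' 1 = W 1" using assms by (simp add: W'_def)
  moreover have "n \<notin> {2..n - 1}" using assms by auto
  ultimately show ?thesis
    unfolding W'_def[symmetric] frac_int_def by simp
qed

lemma second_diff_time_avg:
  "second_diff h (\<lambda>i. time_avg (\<lambda>m. U m i) n) j = time_avg (\<lambda>m. second_diff h (U m) j) n"
  by (cases "h = 0") (simp_all add: second_diff_def time_avg_def field_simps)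

section \<open>Marching through the time levels\<close>

text \<open>
  When the equations at level \<open>n\<close> involve all earlier levels, as a memory term does, the whole history
  has to be carried along: the levels found so far are extended by a new one, which by
  locality does not disturb the equations already solved.
\<close>
lemma level_by_level:
  fixes Q :: "nat \<Rightarrow> (nat \<Rightarrow> 'a) \<Rightarrow> bool"
  assumes local: "\<And>n U U'. n \<in> {1..N} \<Longrightarrow> (\<And>m. m \<le> n \<Longrightarrow> U m = U' m) \<Longrightarrow> Q n U \<Longrightarrow> Q n U'"
    and step: "\<And>n U. n \<in> {1..N} \<Longrightarrow> (\<And>m. m \<in> {1..<n} \<Longrightarrow> Q m U) \<Longrightarrow> \<exists>v. Q n (U(n := v))"
  shows "\<exists>U. U 0 = u0 \<and> (\<forall>n\<in>{1..N}. Q n U)"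
proof -
  have "\<exists>U. U 0 = u0 \<and> (\<forall>n\<in>{1..M}. Q n U)" if "M \<le> N" for M
    using that
  proof (induction M)
    case 0
    show ?case by auto
  next
    case (Suc M)
    then obtain U where U: "U 0 = u0" "\<forall>n\<in>{1..M}. Q n U" by auto
    have "\<exists>v. Q (Suc M) (U(Suc M := v))"
      using Suc.prems U by (intro step) auto
    then obtain v where v: "Q (Suc M) (U(Suc M := v))" ..
    have "Q n (U(Suc M := v))" if "n \<in> {1..Suc M}" for n
    proof (cases "n = Suc M")
      case False
      with that have "Q n U" using U by auto
      then show ?thesis
        by (rule local[rotated 2]) (use that False Suc.prems in auto)
    qed (use v in simp)
    moreover have "(U(Suc M := v)) 0 = u0" using U(1) by simp
    ultimately show ?case by blast
  qed
  then show ?thesis by blast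
qed

text \<open>
  The grid function at which the convection term is evaluated: the scheme is fully implicit
  at the first level and uses the time average at the later ones.
\<close>
definition level_profile :: "(nat \<Rightarrow> nat \<Rightarrow> real) \<Rightarrow> nat \<Rightarrow> nat \<Rightarrow> real" where
  "level_profile U n = (if n = 1 then U 1 else (\<lambda>i. time_avg (\<lambda>m. U m i) n))"

definition solves_level ::
  "real \<Rightarrow> (nat \<Rightarrow> real) \<Rightarrow> real \<Rightarrow> nat \<Rightarrow> (nat \<Rightarrow> nat \<Rightarrow> real) \<Rightarrow> nat \<Rightarrow> (nat \<Rightarrow> nat \<Rightarrow> real) \<Rightarrow> bool" where
  "solves_level \<alpha> t h J f n U \<longleftrightarrow> U n 0 = 0 \<and> U n J = 0 \<and>
     (\<forall>j\<in>{1..J - 1}.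
        time_diff t (\<lambda>m. U m j) n
            + three_point_avg (level_profile U n) j * central_diff h (level_profile U n) j
          = frac_int \<alpha> t (\<lambda>m. second_diff h (U m) j) n + f n j)"

lemma solves_level_local:
  assumes n: "n \<ge> 1" and eq: "\<And>m. m \<le> n \<Longrightarrow> U m = U' m" and "solves_level \<alpha> t h J f n U"
  shows "solves_level \<alpha> t h J f n U'"
proof -
  have "time_diff t (\<lambda>m. U m j) n = time_diff t (\<lambda>m. U' m j) n" for j
    using eq[of n] eq[of "n - 1"] by (simp add: time_diff_def)
  moreover have "level_profile U n = level_profile U' n"
    using eq[of n] eq[of "n - 1"] eq[of 1] n by (simp add: level_profile_def time_avg_def)
  moreover have "frac_int \<alpha> t (\<lambda>m. second_diff h (U m) j) n = frac_int \<alpha> t (\<lambda>m. second_diff h (U' m) j) n" for j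
    using n eq by (intro frac_int_cong) auto
  ultimately show ?thesis
    using assms(3) eq[of n] unfolding solves_level_def by simp
qed

lemma solves_level_first:
  assumes "\<alpha> > 0" "J \<ge> 1" and k: "time_step t 1 > 0"
  shows "\<exists>v. solves_level \<alpha> t h J f 1 (U(1 := v))"
proof -
  define k where "k = time_step t 1"
  define w where "w = frac_weight \<alpha> t 1 1 * k"
  have kpos: "k > 0" using k by (simp add: k_def)
  have "w \<ge> 0" using frac_weight_nonneg[of \<alpha> t 1 1] assms by (simp add: w_def k_def)
  then obtain V where V: "V 0 = 0" "V J = 0" "\<And>j. j \<in> {1..J - 1} \<Longrightarrow>
     1 / k * V j + three_point_avg V j * central_diff h V j = w * second_diff h V j + (f 1 j + U 0 j / k)"
    using one_level_solvable[of "1 / k" w J h "\<lambda>j. f 1 j + U 0 j / k"] kpos assms(2) by auto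
  have "solves_level \<alpha> t h J f 1 (U(1 := V))"
    unfolding solves_level_def
  proof (intro conjI ballI)
    fix j assume "j \<in> {1..J - 1}"
    note eqn = V(3)[OF this]
    have "frac_int \<alpha> t (\<lambda>m. second_diff h ((U(1 := V)) m) j) 1 = w * second_diff h V j"
      by (simp add: frac_int_def w_def k_def)
    moreover have "time_diff t (\<lambda>m. (U(1 := V)) m j) 1 = 1 / k * V j - U 0 j / k"
      by (simp add: time_diff_def k_def diff_divide_distrib)
    ultimately show "time_diff t (\<lambda>m. (U(1 := V)) m j) 1
        + three_point_avg (level_profile (U(1 := V)) 1) j * central_diff h (level_profile (U(1 := V)) 1) j
        = frac_int \<alpha> t (\<lambda>m. second_diff h ((U(1 := V)) m) j) 1 + f 1 j"
      using eqn by (simp add: level_profile_def)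
  qed (use V in auto)
  then show ?thesis by (rule exI[of _ V])
qed

text \<open>
  In terms of the average \<open>V\<close> the time difference is \<open>(2/k)(V - U\<^sup>n\<^sup>-\<^sup>1)\<close>, hence \<open>a = 2/k\<close>. The boundary
  values of \<open>U\<^sup>n\<^sup>-\<^sup>1\<close> must vanish for those of \<open>U\<^sup>n = 2V - U\<^sup>n\<^sup>-\<^sup>1\<close> to vanish together with those of \<open>V\<close>.
\<close>
lemma solves_level_next:
  assumes "\<alpha> > 0" "J \<ge> 1" and n: "n \<ge> 2" and k: "time_step t n > 0"
    and bdry: "U (n - 1) 0 = 0" "U (n - 1) J = 0"
  shows "\<exists>v. solves_level \<alpha> t h J f n (U(n := v))"
proof -
  define k where "k = time_step t n"
  define w where "w = frac_weight \<alpha> t n n * k"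
  define past where "past j = frac_int \<alpha> t
      ((\<lambda>m. second_diff h (U m) j)(n := - second_diff h (U (n - 1)) j)) n" for j
  have kpos: "k > 0" using k by (simp add: k_def)
  have "w \<ge> 0" using frac_weight_nonneg[of \<alpha> t n n] assms by (simp add: w_def k_def)
  then obtain V where V: "V 0 = 0" "V J = 0" "\<And>j. j \<in> {1..J - 1} \<Longrightarrow>
     2 / k * V j + three_point_avg V j * central_diff h V j
       = w * second_diff h V j + (f n j + past j + 2 / k * U (n - 1) j)"
    using one_level_solvable[of "2 / k" w J h "\<lambda>j. f n j + past j + 2 / k * U (n - 1) j"] kpos assms(2) by auto
  define U' where "U' = U(n := (\<lambda>i. 2 * V i - U (n - 1) i))"
  have U'n: "U' n = (\<lambda>i. 2 * V i - U (n - 1) i)" and U'p: "U' (n - 1) = U (n - 1)"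
    using n by (auto simp: U'_def)
  have avg: "(\<lambda>i. time_avg (\<lambda>m. U' m i) n) = V"
    unfolding time_avg_def U'n U'p by simp
  have profile: "level_profile U' n = V"
    using n avg by (simp add: level_profile_def)
  have "solves_level \<alpha> t h J f n U'"
    unfolding solves_level_def profile
  proof (intro conjI ballI)
    fix j assume "j \<in> {1..J - 1}"
    note eqn = V(3)[OF this]
    have "(\<lambda>m. second_diff h (U' m) j)(n := - second_diff h (U' (n - 1)) j)
        = (\<lambda>m. second_diff h (U m) j)(n := - second_diff h (U (n - 1)) j)"
      unfolding U'p by (auto simp: U'_def)
    then have "frac_int \<alpha> t (\<lambda>m. second_diff h (U' m) j) n
        = past j + w * time_avg (\<lambda>m. second_diff h (U' m) j) n"
      using frac_int_split_last[OF n, of \<alpha> t "\<lambda>m. second_diff h (U' m) j"]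
      by (simp add: past_def w_def k_def)
    then have "frac_int \<alpha> t (\<lambda>m. second_diff h (U' m) j) n = past j + w * second_diff h V j"
      using second_diff_time_avg[of h U' n j] by (simp add: avg)
    moreover have "time_diff t (\<lambda>m. U' m j) n = 2 / k * V j - 2 / k * U (n - 1) j"
      unfolding time_diff_def U'n U'p k_def by (simp add: diff_divide_distrib)
    ultimately show "time_diff t (\<lambda>m. U' m j) n
        + three_point_avg V j * central_diff h V j
        = frac_int \<alpha> t (\<lambda>m. second_diff h (U' m) j) n + f n j"
      using eqn by simp
  qed (use V bdry in \<open>auto simp: U'n\<close>)
  then show ?thesis
    unfolding U'_def by (rule exI[of _ "\<lambda>i. 2 * V i - U (n - 1) i"])
qed

theorem theorem4p1:
  fixes L T \<alpha> h :: real and J N :: nat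
    and t :: "nat \<Rightarrow> real" and f :: "nat \<Rightarrow> nat \<Rightarrow> real" and U0 :: "nat \<Rightarrow> real"
  assumes "L > 0" and "T > 0" and "0 < \<alpha>" and "\<alpha> < 1"
    and "J \<ge> 1" and "N \<ge> 1"
    and "h = L / real J"
    and "time_grid t T N"
  shows "\<exists>U :: nat \<Rightarrow> nat \<Rightarrow> real.
    (\<forall>j\<in>{1..J - 1}. U 0 j = U0 j) \<and>
    (\<forall>n\<in>{1..N}. U n 0 = 0 \<and> U n J = 0) \<and>
    (\<forall>j\<in>{1..J - 1}.
       time_diff t (\<lambda>m. U m j) 1 + three_point_avg (U 1) j * central_diff h (U 1) j
         = frac_int \<alpha> t (\<lambda>m. second_diff h (U m) j) 1 + f 1 j) \<and>
    (\<forall>n\<in>{2..N}. \<forall>j\<in>{1..J - 1}.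
       time_diff t (\<lambda>m. U m j) n
           + three_point_avg (\<lambda>i. time_avg (\<lambda>m. U m i) n) j
             * central_diff h (\<lambda>i. time_avg (\<lambda>m. U m i) n) j
         = frac_int \<alpha> t (\<lambda>m. second_diff h (U m) j) n + f n j)"
proof -
  have k: "time_step t n > 0" if "n \<in> {1..N}" for n
    using \<open>time_grid t T N\<close> that
    by (auto simp: time_grid_def time_step_def strict_mono_on_def)
  have "\<exists>U. U 0 = U0 \<and> (\<forall>n\<in>{1..N}. solves_level \<alpha> t h J f n U)"
  proof (rule level_by_level)
    show "solves_level \<alpha> t h J f n U'"
      if "n \<in> {1..N}" "\<And>m. m \<le> n \<Longrightarrow> U m = U' m" "solves_level \<alpha> t h J f n U" for n U U'
      using solves_level_local[of n U U'] that by simp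
    fix n and U :: "nat \<Rightarrow> nat \<Rightarrow> real"
    assume n: "n \<in> {1..N}"
      and prev: "\<And>m. m \<in> {1..<n} \<Longrightarrow> solves_level \<alpha> t h J f m U"
    show "\<exists>v. solves_level \<alpha> t h J f n (U(n := v))"
    proof (cases "n = 1")
      case True
      then show ?thesis using solves_level_first[OF \<open>0 < \<alpha>\<close> \<open>J \<ge> 1\<close>] k n by blast
    next
      case False
      with n have n2: "n \<ge> 2" and "n - 1 \<in> {1..<n}" by auto
      then have "U (n - 1) 0 = 0" "U (n - 1) J = 0"
        using prev[of "n - 1"] by (auto simp: solves_level_def)
      then show ?thesis using solves_level_next[OF \<open>0 < \<alpha>\<close> \<open>J \<ge> 1\<close> n2 k[OF n]] by blast
    qed
  qed
  then obtain U where U: "U 0 = U0" "\<And>n. n \<in> {1..N} \<Longrightarrow> solves_level \<alpha> t h J f n U" by auto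
  show ?thesis
  proof (intro exI[of _ U] conjI ballI)
    show "U 0 j = U0 j" for j by (simp add: U)
    show "U n 0 = 0" "U n J = 0" if "n \<in> {1..N}" for n
      using U(2)[OF that] by (auto simp: solves_level_def)
    show "time_diff t (\<lambda>m. U m j) 1 + three_point_avg (U 1) j * central_diff h (U 1) j
         = frac_int \<alpha> t (\<lambda>m. second_diff h (U m) j) 1 + f 1 j" if "j \<in> {1..J - 1}" for j
      using U(2)[of 1] \<open>N \<ge> 1\<close> that by (simp add: solves_level_def level_profile_def)
    show "time_diff t (\<lambda>m. U m j) n + three_point_avg (\<lambda>i. time_avg (\<lambda>m. U m i) n) j
             * central_diff h (\<lambda>i. time_avg (\<lambda>m. U m i) n) j
         = frac_int \<alpha> t (\<lambda>m. second_diff h (U m) j) n + f n j"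
      if "n \<in> {2..N}" "j \<in> {1..J - 1}" for n j
      using U(2)[of n] that by (simp add: solves_level_def level_profile_def)
  qed
qed

end
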